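(* Let $p$ be a prime and let $\overline{\mathbb{F}}_p$ be an algebraic closure of $\mathbb{F}_p$. If $f\in\overline{\mathbb{F}}_p[x^p]$ (that is, $f$ is a polynomial in $x^p$ with coefficients in $\overline{\mathbb{F}}_p$) and $\deg f\geq 2$, then $\zeta_f(\overline{\mathbb{F}}_p;t)\in\mathbb{Q}(t)$. In particular, if $m\geq 2$ is an integer with $p\mid m$, then $\zeta_{x^m}(\overline{\mathbb{F}}_p;t)\in\mathbb{Q}(t)$. If $m\geq 2$ is an integer with $p\nmid m$, then $\zeta_{x^m}(\overline{\mathbb{F}}_p;t)$ is transcendental over $\mathbb{Q}(t)$.
   Context: For a polynomial $f\in\overline{\mathbb{F}}_p[x]$ of degree $d\geq 2$, regard $f$ as a self-map of $\mathbb{A}^1(\overline{\mathbb{F}}_p)=\overline{\mathbb{F}}_p$. Write $f^n$ for $f$ composed with itself $n$ times, and let $a_n=\#\{x\in\overline{\mathbb{F}}_p : f^n(x)=x\}$, the number of fixed points of $f^n$, counted without multiplicity (this is finite, with $a_n\leq d^n$). The Artin-Mazur zeta function of $f$ is the formal power series $$\zeta_f(\overline{\mathbb{F}}_p;t)=\exp\left(\sum_{n=1}^\infty a_n\frac{t^n}{n}\right)\in\mathbb{Q}[[t]].$$ Here $\zeta_{x^m}$ denotes the zeta function of the map $x\mapsto x^m$. Rationality (membership in $\mathbb{Q}(t)$) and transcendence over $\mathbb{Q}(t)$ are understood inside the field of formal Laurent series $\mathbb{Q}((t))$, which contains both $\mathbb{Q}(t)$ and $\mathbb{Q}[[t]]$.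 *)

theory Defs
  imports "HOL-Algebra.Algebraic_Closure_Type"
begin

definition algebraic_over :: "'a::field set \<Rightarrow> 'a \<Rightarrow> bool" where
  "algebraic_over K x \<longleftrightarrow>
     (\<exists>P. P \<noteq> 0 \<and> (\<forall>i. Polynomial.coeff P i \<in> K) \<and> poly P x = 0)"

abbreviation transcendental_over :: "'a::field set \<Rightarrow> 'a \<Rightarrow> bool" where
  "transcendental_over K x \<equiv> \<not> algebraic_over K x"

lemma eval_ring_of_type_algebra:
  "ring.eval (ring_of_type_algebra :: 'a::field ring) ps x = poly (Poly (rev ps)) x"
proof -
  interpret R: field "ring_of_type_algebra :: 'a ring" by rule
  have pow: "x [^]\<^bsub>ring_of_type_algebra\<^esub> n = x ^ n" for n :: nat
    by (induction n) (auto simp: ring_of_type_algebra_def nat_pow_def mult.commute)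
  show ?thesis
    by (induction ps)
      (auto simp: pow, auto simp: ring_of_type_algebra_def Poly_append poly_monom)
qed

text \<open>
  On a subring, the type-class notion above is the same as the one that HOL-Algebra
  defines for ring records.
\<close>

lemma algebraic_over_iff_ring_algebraic:
  assumes "subring K (ring_of_type_algebra :: 'a::field ring)"
  shows "algebraic_over K x \<longleftrightarrow> ring.algebraic (ring_of_type_algebra :: 'a ring) K x"
proof -
  let ?R = "ring_of_type_algebra :: 'a ring"
  interpret R: field ?R by rule
  have x: "x \<in> carrier ?R" and z: "\<zero>\<^bsub>?R\<^esub> = 0"
    by (simp_all add: ring_of_type_algebra_def)
  have 0: "0 \<in> K"
    using subringE(2)[OF assms] by (simp add: z)
  show ?thesis
  proof
    assume "algebraic_over K x"
    then obtain P where P: "P \<noteq> 0" "\<And>i. Polynomial.coeff P i \<in> K" "poly P x = 0"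
      by (auto simp: algebraic_over_def)
    let ?ps = "rev (coeffs P)"
    have "set ?ps \<subseteq> K"
      using P(2) by (auto simp: coeffs_def)
    moreover have "?ps \<noteq> []" "hd ?ps \<noteq> 0"
      using P(1) by (simp_all add: hd_rev last_coeffs_eq_coeff_degree)
    ultimately have "?ps \<in> carrier (K [X]\<^bsub>?R\<^esub>)"
      by (simp add: univ_poly_carrier[symmetric] polynomial_def z)
    moreover have "R.eval ?ps x = \<zero>\<^bsub>?R\<^esub>"
      using P(3) by (simp add: eval_ring_of_type_algebra z)
    ultimately show "R.algebraic K x"
      using R.algebraicI[of ?ps K x] \<open>?ps \<noteq> []\<close> by (simp add: over_def)
  next
    assume "R.algebraic K x"
    then obtain ps where ps: "ps \<in> carrier (K [X]\<^bsub>?R\<^esub>)" "ps \<noteq> []" "R.eval ps x = \<zero>\<^bsub>?R\<^esub>"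
      using R.algebraicE[OF assms x] by (auto simp: over_def)
    then have sub: "set ps \<subseteq> K" and hd: "hd ps \<noteq> 0"
      by (simp_all add: univ_poly_carrier[symmetric] polynomial_def z)
    let ?P = "Poly (rev ps)"
    have "Polynomial.coeff ?P (length ps - 1) \<noteq> 0"
      using ps(2) hd by (simp add: nth_default_def rev_nth hd_conv_nth)
    then have "?P \<noteq> 0"
      by (metis coeff_0)
    moreover have "Polynomial.coeff ?P i \<in> K" for i
      using sub 0 nth_mem[of i "rev ps"] by (auto simp: nth_default_def simp del: nth_mem)
    moreover have "poly ?P x = 0"
      using ps(3) by (simp add: eval_ring_of_type_algebra z)
    ultimately show "algebraic_over K x"
      unfolding algebraic_over_def by blast
  qed
qed

text \<open>
  The image of the integers. In prime characteristic \<open>p\<close> this is the canonical copy of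
  the field with \<open>p\<close> elements, so an algebraically closed field of characteristic \<open>p\<close> that is
  algebraic over this set is an algebraic closure of that field.
\<close>

definition prime_subfield :: "'a::field set" where
  "prime_subfield = range of_int"

text \<open>The rational functions, as a subset of the field of formal Laurent series.\<close>

definition rational_functions :: "'a::field fls set" where
  "rational_functions =
     {fps_to_fls (fps_of_poly P) / fps_to_fls (fps_of_poly Q) | P Q. Q \<noteq> 0}"

text \<open>
  The set below is infinite for \<open>n = 0\<close> over an infinite field, but that value is never used;
  for \<open>n > 0\<close> and \<open>degree f \<ge> 2\<close> it is finite, being the root set of a nonzero polynomial.
\<close>

definition num_fixed_points :: "'a::field poly \<Rightarrow> nat \<Rightarrow> nat" where
  "num_fixed_points f n = card {x. (poly f ^^ n) x = x}"

definition artin_mazur_zeta :: "'a::field poly \<Rightarrow> rat fps" where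
  "artin_mazur_zeta f =
     fps_exp 1 oo Abs_fps (\<lambda>n. if n = 0 then 0 else of_nat (num_fixed_points f n) / of_nat n)"

end

theory Submission
  imports Defs "HOL-Number_Theory.Residues"
begin

text \<open>
  If \<open>f\<close> is a polynomial in \<open>x^p\<close>, then every \<open>f^n(x) - x\<close> has derivative \<open>-1\<close>, so it is
  separable, \<open>a_n = d^n\<close>, and the zeta function is \<open>1 / (1 - d t)\<close>.

  For \<open>f = x^m\<close> with \<open>p\<close> not dividing \<open>m\<close>, \<open>a_n\<close> is one more than the prime-to-\<open>p\<close> part of
  \<open>m^n - 1\<close>. Suppose that \<open>\<zeta>\<close> is algebraic over \<open>K = \<rat>(t)\<close>. The field \<open>K(\<zeta>)\<close> has finite dimension
  over \<open>K\<close> and is closed under \<open>\<theta> = t d/dt\<close>, so the iterates of \<open>\<theta>\<close> on \<open>\<theta>\<zeta> / \<zeta> = \<Sum> a_n t^n\<close>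
  are linearly dependent over \<open>K\<close>. Hence \<open>a_n\<close> satisfies a nontrivial recurrence
  \<open>\<Sum>j\<le>J. q_j(n - j) a_(n - j) = 0\<close> with polynomial coefficients. Evaluate it at \<open>n = j0 + L\<close>
  with \<open>L = \<phi>(p^(N + 1)) w\<close> and \<open>w \<equiv> 1 (mod p)\<close>: as \<open>w\<close> varies, all \<open>p\<close>-adic valuations of
  \<open>m^(n - j) - 1\<close> stay constant, and the one for \<open>j = j0\<close> tends to infinity with \<open>N\<close> while the
  others do not depend on \<open>N\<close>. Separating polynomials in \<open>L\<close> from multiples of \<open>m^L\<close> and
  comparing two values of \<open>N\<close> gives \<open>q_j0 = 0\<close> for every \<open>j0\<close>.
\<close>

subsection \<open>Logarithmic derivatives of algebraic elements\<close>

text \<open>Gaussian elimination, one equation at a time: the surplus of unknowns over equations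
  survives each step. The scalars form a subset \<open>K\<close> closed under the field operations,
  so that the lemma applies to a subfield that is not a type.\<close>

lemma homogeneous_system_solvable:
  fixes v :: "'i \<Rightarrow> nat \<Rightarrow> 'a::field"
  assumes K: "0 \<in> K" "1 \<in> K" "\<And>x y. x \<in> K \<Longrightarrow> y \<in> K \<Longrightarrow> x + y \<in> K"
    "\<And>x. x \<in> K \<Longrightarrow> - x \<in> K" "\<And>x y. x \<in> K \<Longrightarrow> y \<in> K \<Longrightarrow> x * y \<in> K"
    "\<And>x. x \<in> K \<Longrightarrow> inverse x \<in> K"
    and "finite I" "card I > n" "\<And>i j. v i j \<in> K"
  shows "\<exists>c. (\<forall>i. c i \<in> K) \<and> (\<exists>i\<in>I. c i \<noteq> 0) \<and> (\<forall>j<n. (\<Sum>i\<in>I. c i * v i j) = 0)"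
  using assms(7-)
proof (induction n arbitrary: I v)
  case 0
  then have "I \<noteq> {}" by auto
  then show ?case
    using K(2) by (intro exI[of _ "\<lambda>_. 1"]) auto
next
  case (Suc n)
  show ?case
  proof (cases "\<forall>i\<in>I. v i n = 0")
    case True
    obtain c where "\<forall>i. c i \<in> K" "\<exists>i\<in>I. c i \<noteq> 0" "\<forall>j<n. (\<Sum>i\<in>I. c i * v i j) = 0"
      using Suc.IH[of I v] Suc.prems by auto
    with True show ?thesis
      by (intro exI[of _ c]) (auto simp: less_Suc_eq)
  next
    case False
    then obtain k where k: "k \<in> I" "v k n \<noteq> 0" by blast
    define I' where "I' = I - {k}"
    \<comment> \<open>Row reduction with pivot \<open>v k n\<close>: subtracting multiples of row
      \<open>k\<close> clears column \<open>n\<close>.\<close>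
    define v' where "v' i j = v i j + - (v i n * inverse (v k n) * v k j)" for i j
    have I': "finite I'" "card I' > n" "I = insert k I'" "k \<notin> I'"
      using Suc.prems k by (auto simp: I'_def)
    have "v' i j \<in> K" for i j
      unfolding v'_def by (intro K Suc.prems)
    then obtain c where c: "\<forall>i. c i \<in> K" "\<exists>i\<in>I'. c i \<noteq> 0" "\<forall>j<n. (\<Sum>i\<in>I'. c i * v' i j) = 0"
      using Suc.IH[of I' v'] I' by blast
    \<comment> \<open>Equation \<open>n\<close> forces this coefficient for the pivot row once the
      others are chosen.\<close>
    define ck where "ck = (\<Sum>i\<in>I'. - (c i * v i n * inverse (v k n)))"
    have sumK: "(\<Sum>i\<in>A. g i) \<in> K" if "\<And>i. g i \<in> K" for A :: "'i set" and g
      using that by (induction A rule: infinite_finite_induct) (auto intro: K)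
    have ckK: "ck \<in> K"
      unfolding ck_def using c(1) by (intro sumK K Suc.prems) auto
    have eq: "(\<Sum>i\<in>I. (c(k := ck)) i * v i j) = (\<Sum>i\<in>I'. c i * v' i j)" for j
    proof -
      have "(\<Sum>i\<in>I. (c(k := ck)) i * v i j) = ck * v k j + (\<Sum>i\<in>I'. c i * v i j)"
        using I' by (simp add: sum.insert) (intro sum.cong, auto)
      also have "\<dots> = (\<Sum>i\<in>I'. c i * v' i j)"
        unfolding ck_def v'_def
        by (simp add: sum_distrib_right flip: sum.distrib) (simp add: algebra_simps)
      finally show ?thesis .
    qed
    have "v' i n = 0" for i
      using k by (simp add: v'_def)
    then have "\<forall>j<Suc n. (\<Sum>i\<in>I. (c(k := ck)) i * v i j) = 0"
      using c(3) unfolding eq by (auto simp: less_Suc_eq)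
    moreover have "\<exists>i\<in>I. (c(k := ck)) i \<noteq> 0"
      using c(2) I' by (metis fun_upd_apply insertCI)
    ultimately show ?thesis
      using c(1) ckK by (intro exI[of _ "c(k := ck)"]) auto
  qed
qed

text \<open>
  A differential subfield \<open>K\<close>, and an element \<open>z\<close> with minimal polynomial \<open>P\<close> over \<open>K\<close>.
\<close>

locale algebraic_differential =
  fixes K :: "'a::field_char_0 set" and D :: "'a \<Rightarrow> 'a" and z :: 'a and P :: "'a poly" and d :: nat
  assumes zero [simp]: "0 \<in> K" and one [simp]: "1 \<in> K"
    and add: "x \<in> K \<Longrightarrow> y \<in> K \<Longrightarrow> x + y \<in> K"
    and uminus: "x \<in> K \<Longrightarrow> - x \<in> K"
    and mult: "x \<in> K \<Longrightarrow> y \<in> K \<Longrightarrow> x * y \<in> K"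
    and inverse: "x \<in> K \<Longrightarrow> inverse x \<in> K"
    and D_add: "D (x + y) = D x + D y"
    and D_mult: "D (x * y) = x * D y + D x * y"
    and D_K: "x \<in> K \<Longrightarrow> D x \<in> K"
    and P_nonzero: "P \<noteq> 0" and P_coeff: "Polynomial.coeff P i \<in> K" and P_root: "poly P z = 0"
    and P_min: "\<And>Q. Q \<noteq> 0 \<Longrightarrow> (\<forall>i. Polynomial.coeff Q i \<in> K) \<Longrightarrow> poly Q z = 0 \<Longrightarrow>
       Polynomial.degree P \<le> Polynomial.degree Q"
    and d_def: "d = Polynomial.degree P"
begin

lemma of_nat_in: "of_nat n \<in> K"
  by (induction n) (auto intro: add)

lemma D_0: "D 0 = 0"
  using D_add[of 0 0] by simp

lemma d_pos: "d > 0"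
proof (rule ccontr)
  assume "\<not> d > 0"
  then obtain a where "P = [:a:]"
    using d_def degree_eq_zeroE[of P] by auto
  with P_nonzero P_root show False by auto
qed

text \<open>
  \<^term>\<open>S\<close> is the field \<open>K(z)\<close>: every element is a polynomial in \<open>z\<close> of degree below \<open>d\<close>.
\<close>

definition S where "S = {\<Sum>j<d. v j * z ^ j | v. \<forall>j. v j \<in> K}"

lemma S_I: "(\<And>j. v j \<in> K) \<Longrightarrow> x = (\<Sum>j<d. v j * z ^ j) \<Longrightarrow> x \<in> S"
  unfolding S_def by blast

lemma S_0: "0 \<in> S"
  by (rule S_I[of "\<lambda>_. 0"]) auto

lemma S_add: "x \<in> S \<Longrightarrow> y \<in> S \<Longrightarrow> x + y \<in> S"
  unfolding S_def
proof safe
  fix v w :: "nat \<Rightarrow> 'a" assume "\<forall>j. v j \<in> K" "\<forall>j. w j \<in> K"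
  then show "\<exists>u. (\<Sum>j<d. v j * z ^ j) + (\<Sum>j<d. w j * z ^ j) = (\<Sum>j<d. u j * z ^ j) \<and> (\<forall>j. u j \<in> K)"
    by (intro exI[of _ "\<lambda>j. v j + w j"]) (auto simp: algebra_simps sum.distrib intro: add)
qed

lemma S_scale: "c \<in> K \<Longrightarrow> x \<in> S \<Longrightarrow> c * x \<in> S"
  unfolding S_def
proof safe
  fix v :: "nat \<Rightarrow> 'a" assume "\<forall>j. v j \<in> K" "c \<in> K"
  then show "\<exists>u. c * (\<Sum>j<d. v j * z ^ j) = (\<Sum>j<d. u j * z ^ j) \<and> (\<forall>j. u j \<in> K)"
    by (intro exI[of _ "\<lambda>j. c * v j"]) (auto simp: algebra_simps sum_distrib_left intro: mult)
qed

lemma S_sum: "(\<And>i. i \<in> A \<Longrightarrow> g i \<in> S) \<Longrightarrow> (\<Sum>i\<in>A. g i) \<in> S"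
  by (induction A rule: infinite_finite_induct) (auto intro: S_add S_0)

lemma power_less_in_S: "j < d \<Longrightarrow> z ^ j \<in> S"
  by (rule S_I[of "\<lambda>i. if i = j then 1 else 0"]) (auto simp: if_distrib if_distribR cong: if_cong)

text \<open>Solve \<open>P(z) = 0\<close> for its leading term.\<close>

lemma power_d_in_S: "z ^ d \<in> S"
proof -
  let ?a = "Polynomial.coeff P"
  have nz: "?a d \<noteq> 0"
    using P_nonzero by (simp add: d_def)
  have "(\<Sum>i<d. ?a i * z ^ i) + ?a d * z ^ d = 0"
    using P_root by (simp add: poly_altdef d_def lessThan_Suc_atMost[symmetric])
  then have "z ^ d = - inverse (?a d) * (\<Sum>i<d. ?a i * z ^ i)"
    using nz by (simp add: field_simps eq_neg_iff_add_eq_0)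
  also have "\<dots> \<in> S"
    by (intro S_scale uminus inverse P_coeff S_I[of ?a]) auto
  finally show ?thesis .
qed

lemma S_mult_z: "x \<in> S \<Longrightarrow> z * x \<in> S"
proof -
  assume "x \<in> S"
  then obtain v where v: "\<forall>j. v j \<in> K" "x = (\<Sum>j<d. v j * z ^ j)"
    by (auto simp: S_def)
  have "z * x = (\<Sum>j<d. v j * z ^ Suc j)"
    unfolding v(2) sum_distrib_left by (intro sum.cong) (auto simp: algebra_simps)
  moreover have "z ^ Suc j \<in> S" if "j < d" for j
    using that power_less_in_S[of "Suc j"] power_d_in_S by (cases "Suc j = d") auto
  ultimately show ?thesis
    using v(1) by (auto simp del: power_Suc intro!: S_sum S_scale)
qed

lemma S_mult: "x \<in> S \<Longrightarrow> y \<in> S \<Longrightarrow> x * y \<in> S"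
proof -
  assume "x \<in> S" and y: "y \<in> S"
  then obtain v where v: "\<forall>j. v j \<in> K" "x = (\<Sum>j<d. v j * z ^ j)"
    by (auto simp: S_def)
  have "z ^ j * y \<in> S" for j
    by (induction j) (auto simp: y mult.assoc intro: S_mult_z)
  then show ?thesis
    unfolding v(2) sum_distrib_right mult.assoc using v(1) by (intro S_sum) (rule S_scale, auto)
qed

lemma S_1: "1 \<in> S"
  using power_less_in_S[of 0] d_pos by simp

lemma K_S: "x \<in> K \<Longrightarrow> x \<in> S"
  using S_scale[OF _ S_1, of x] by simp

lemma z_S: "z \<in> S"
  using S_mult_z[OF S_1] by simp

lemma poly_S: "(\<And>i. Polynomial.coeff Q i \<in> K) \<Longrightarrow> x \<in> S \<Longrightarrow> poly Q x \<in> S"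
proof (induction Q)
  case (pCons a Q)
  have "a \<in> K" using pCons.prems(1)[of 0] by simp
  moreover have "Polynomial.coeff Q i \<in> K" for i using pCons.prems(1)[of "Suc i"] by simp
  ultimately show ?case
    using pCons K_S[of a] S_add[of a] S_mult[of x "poly Q x"] by simp
qed (auto intro: S_0)

text \<open>Expanding each element in the \<open>d\<close> spanning powers of \<open>z\<close> turns
  a relation into \<open>d\<close> linear equations, fewer than the unknowns.\<close>

lemma S_dependent:
  assumes "finite I" "card I > d" "\<And>i. i \<in> I \<Longrightarrow> x i \<in> S"
  shows "\<exists>c. (\<forall>i. c i \<in> K) \<and> (\<exists>i\<in>I. c i \<noteq> 0) \<and> (\<Sum>i\<in>I. c i * x i) = 0"
proof -
  have "\<exists>v. (\<forall>j. v j \<in> K) \<and> (i \<in> I \<longrightarrow> x i = (\<Sum>j<d. v j * z ^ j))" for i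
    using assms(3)[of i] zero unfolding S_def by (cases "i \<in> I") (blast, auto intro: exI[of _ "\<lambda>_. 0"])
  then obtain v where v: "\<And>i j. v i j \<in> K" "\<And>i. i \<in> I \<Longrightarrow> x i = (\<Sum>j<d. v i j * z ^ j)"
    by metis
  obtain c where c: "\<forall>i. c i \<in> K" "\<exists>i\<in>I. c i \<noteq> 0" "\<forall>j<d. (\<Sum>i\<in>I. c i * v i j) = 0"
    using homogeneous_system_solvable[of K I d v, OF zero one add uminus mult inverse assms(1,2) v(1)]
    by blast
  have "(\<Sum>i\<in>I. c i * x i) = (\<Sum>i\<in>I. \<Sum>j<d. c i * v i j * z ^ j)"
    by (intro sum.cong) (auto simp: v(2) sum_distrib_left mult.assoc)
  also have "\<dots> = (\<Sum>j<d. (\<Sum>i\<in>I. c i * v i j) * z ^ j)"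
    by (subst sum.swap) (simp add: sum_distrib_right)
  also have "\<dots> = 0" using c(3) by simp
  finally show ?thesis using c by blast
qed

text \<open>Since \<open>w\<close> is nonzero, factors of the variable can be stripped from the
  annihilating polynomial until its constant term \<open>a\<close> is nonzero; then
  \<open>a + w * C(w) = 0\<close> exhibits the inverse.\<close>

lemma inverse_in_S_if_root:
  assumes "C \<noteq> 0" "\<And>i. Polynomial.coeff C i \<in> K" "poly C w = 0" "w \<noteq> 0" "w \<in> S"
  shows "inverse w \<in> S"
  using assms
proof (induction C)
  case (pCons a C)
  have a: "a \<in> K" using pCons.prems(2)[of 0] by simp
  have C: "Polynomial.coeff C i \<in> K" for i using pCons.prems(2)[of "Suc i"] by simp
  show ?case
  proof (cases "a = 0")
    case True
    then show ?thesis using pCons C by auto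
  next
    case False
    then have "w * (- inverse a * poly C w) = 1"
      using pCons.prems(3) by (simp add: field_simps eq_neg_iff_add_eq_0 neg_eq_iff_add_eq_0)
    then have "inverse w = - inverse a * poly C w"
      by (rule inverse_unique)
    also have "\<dots> \<in> S"
      by (intro S_scale uminus inverse a poly_S C pCons.prems)
    finally show ?thesis .
  qed
qed auto

text \<open>The \<open>d + 1\<close> powers \<open>w^0, ..., w^d\<close> are dependent over
  \<open>K\<close>, which supplies a polynomial annihilating \<open>w\<close>.\<close>

lemma S_inverse:
  assumes "w \<in> S" "w \<noteq> 0"
  shows "inverse w \<in> S"
proof -
  have "w ^ i \<in> S" for i
    by (induction i) (auto intro: S_1 S_mult assms)
  then obtain c where c: "\<forall>i. c i \<in> K" "\<exists>i\<in>{..d}. c i \<noteq> 0" "(\<Sum>i\<in>{..d}. c i * w ^ i) = 0"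
    using S_dependent[of "{..d}" "\<lambda>i. w ^ i"] by auto
  define C where "C = (\<Sum>i\<le>d. Polynomial.monom (c i) i)"
  have coeff: "Polynomial.coeff C i = (if i \<le> d then c i else 0)" for i
    by (auto simp: C_def coeff_sum)
  have "C \<noteq> 0"
    using c(2) coeff by (metis atMost_iff coeff_0)
  moreover have "poly C w = 0"
    using c(3) by (simp add: C_def poly_sum poly_monom)
  ultimately show ?thesis
    using inverse_in_S_if_root[of C w] assms c(1) by (auto simp: coeff)
qed

lemma D_poly: "D (poly Q z) = poly (map_poly D Q) z + poly (pderiv Q) z * D z"
  by (induction Q) (auto simp: D_0 D_add D_mult map_poly_pCons pderiv_pCons algebra_simps)

lemma D_z_in_S: "D z \<in> S"
proof -
  \<comment> \<open>Differentiate \<open>P(z) = 0\<close>; the factor \<open>P'(z)\<close> is nonzero by minimality of \<open>P\<close>.\<close>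
  have coeff: "Polynomial.coeff (pderiv P) i \<in> K" for i
    unfolding coeff_pderiv by (intro mult of_nat_in P_coeff)
  \<comment> \<open>Characteristic zero: a polynomial of positive degree has nonzero
    derivative.\<close>
  have "pderiv P \<noteq> 0"
    using d_pos by (simp add: pderiv_eq_0_iff d_def)
  then have nz: "poly (pderiv P) z \<noteq> 0"
    using P_min[of "pderiv P"] coeff d_pos by (auto simp: degree_pderiv d_def)
  have "poly (map_poly D P) z + poly (pderiv P) z * D z = 0"
    using D_poly[of P] by (simp add: P_root D_0)
  then have "D z = -1 * (poly (map_poly D P) z * inverse (poly (pderiv P) z))"
    using nz by (simp add: field_simps eq_neg_iff_add_eq_0)
  also have "\<dots> \<in> S"
    using nz by (intro S_scale S_mult uminus one S_inverse poly_S z_S coeff)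
      (auto simp: coeff_map_poly D_0 intro: D_K P_coeff)
  finally show ?thesis .
qed

lemma D_S: "x \<in> S \<Longrightarrow> D x \<in> S"
proof -
  assume "x \<in> S"
  then obtain v where v: "\<forall>j. v j \<in> K" "x = (\<Sum>j<d. v j * z ^ j)"
    by (auto simp: S_def)
  have "D (z ^ j) \<in> S \<and> z ^ j \<in> S" for j
  proof (induction j)
    case 0
    show ?case using D_K[OF one] by (auto intro: K_S)
  qed (auto simp: D_mult intro!: S_add S_mult z_S D_z_in_S)
  moreover have "D (\<Sum>j\<in>A. g j) = (\<Sum>j\<in>A. D (g j))" for A :: "nat set" and g
    by (induction A rule: infinite_finite_induct) (auto simp: D_0 D_add)
  ultimately show ?thesis
    using v by (auto simp: D_mult intro!: S_sum S_add S_scale D_K)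
qed

lemma log_derivative_dependent:
  assumes "z \<noteq> 0"
  shows "\<exists>c. (\<forall>i. c i \<in> K) \<and> (\<exists>i\<in>{..d}. c i \<noteq> 0) \<and> (\<Sum>i\<le>d. c i * (D ^^ i) (D z / z)) = 0"
proof (rule S_dependent)
  have "D z / z \<in> S"
    unfolding divide_inverse by (intro S_mult D_z_in_S S_inverse z_S assms)
  then show "(D ^^ i) (D z / z) \<in> S" for i
    by (induction i) (auto intro: D_S)
qed auto

end

subsection \<open>Rational functions and polynomial recurrences\<close>

text \<open>Unlike plain differentiation, this derivation acts diagonally on coefficients,
  multiplying the one at \<open>t^n\<close> by \<open>n\<close>.\<close>

definition theta :: "'a::field fls \<Rightarrow> 'a fls" where
  "theta y = fls_X * fls_deriv y"

lemma theta_add: "theta (x + y) = theta x + theta y"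
  by (simp add: theta_def algebra_simps)

lemma theta_mult: "theta (x * y) = x * theta y + theta x * y"
  by (simp add: theta_def algebra_simps)

abbreviation fls_of_poly :: "'a::field poly \<Rightarrow> 'a fls" where
  "fls_of_poly P \<equiv> fps_to_fls (fps_of_poly P)"

lemma fls_of_poly_eq_0_iff: "fls_of_poly P = 0 \<longleftrightarrow> P = 0"
  using fps_of_poly_eq_iff[of P 0] by simp

section \<open>The differential field of rational functions\<close>

lemma rational_functionsI: "Q \<noteq> 0 \<Longrightarrow> x = fls_of_poly P / fls_of_poly Q \<Longrightarrow> x \<in> rational_functions"
  unfolding rational_functions_def by blast

lemma rational_functionsE:
  assumes "x \<in> rational_functions"
  obtains P Q where "Q \<noteq> 0" "x = fls_of_poly P / fls_of_poly Q"
  using assms unfolding rational_functions_def by blast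

lemma fls_of_poly_simps:
  "fls_of_poly (P + Q) = fls_of_poly P + fls_of_poly Q"
  "fls_of_poly (P * Q) = fls_of_poly P * fls_of_poly Q"
  by (simp_all add: fps_of_poly_add fps_of_poly_mult fls_times_fps_to_fls)

lemma fls_of_poly_in: "fls_of_poly P \<in> rational_functions"
  by (rule rational_functionsI[of 1 _ P]) auto

lemma rational_functions_add:
  "x \<in> rational_functions \<Longrightarrow> y \<in> rational_functions \<Longrightarrow> x + y \<in> rational_functions"
proof (elim rational_functionsE)
  fix P Q R T :: "'a poly"
  assume "Q \<noteq> 0" "T \<noteq> 0" "x = fls_of_poly P / fls_of_poly Q" "y = fls_of_poly R / fls_of_poly T"
  then show ?thesis
    by (intro rational_functionsI[of "Q * T" _ "P * T + R * Q"])
      (auto simp: fls_of_poly_simps fls_of_poly_eq_0_iff field_simps)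
qed

lemma rational_functions_mult:
  "x \<in> rational_functions \<Longrightarrow> y \<in> rational_functions \<Longrightarrow> x * y \<in> rational_functions"
proof (elim rational_functionsE)
  fix P Q R T :: "'a poly"
  assume "Q \<noteq> 0" "T \<noteq> 0" "x = fls_of_poly P / fls_of_poly Q" "y = fls_of_poly R / fls_of_poly T"
  then show ?thesis
    by (intro rational_functionsI[of "Q * T" _ "P * R"])
      (auto simp: fls_of_poly_simps fls_of_poly_eq_0_iff field_simps)
qed

lemma rational_functions_uminus:
  "x \<in> rational_functions \<Longrightarrow> - x \<in> rational_functions"
  using rational_functions_mult[OF fls_of_poly_in[of "-1"], of x]
  by (simp add: fps_of_poly_uminus)

lemma rational_functions_inverse:
  "x \<in> rational_functions \<Longrightarrow> inverse x \<in> rational_functions"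
proof (elim rational_functionsE)
  fix P Q :: "'a poly"
  assume *: "Q \<noteq> 0" "x = fls_of_poly P / fls_of_poly Q"
  show ?thesis
  proof (cases "P = 0")
    case True
    then show ?thesis using * fls_of_poly_in[of 0] by simp
  next
    case False
    then show ?thesis
      using * by (intro rational_functionsI[of P _ Q]) auto
  qed
qed

lemma rational_functions_theta:
  "x \<in> rational_functions \<Longrightarrow> theta x \<in> rational_functions"
proof (elim rational_functionsE)
  fix P Q :: "'a poly"
  assume Q: "Q \<noteq> 0" and x: "x = fls_of_poly P / fls_of_poly Q"
  have th: "theta (fls_of_poly R) = fls_of_poly ([:0, 1:] * pderiv R)" for R :: "'a poly"
    unfolding theta_def fls_of_poly_simps(2) fps_of_poly_fps_X fps_of_poly_pderiv fls_deriv_fps_to_fls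
    by (simp add: fls_times_fps_to_fls)
  \<comment> \<open>The quotient rule, obtained from the product rule on
    \<open>P = x * Q\<close>.\<close>
  have "theta (fls_of_poly P) = x * theta (fls_of_poly Q) + theta x * fls_of_poly Q"
    using Q by (subst theta_mult[symmetric]) (simp add: x fls_of_poly_eq_0_iff)
  then have "theta x = (theta (fls_of_poly P) + - (x * theta (fls_of_poly Q))) * inverse (fls_of_poly Q)"
    using Q by (simp add: field_simps fls_of_poly_eq_0_iff)
  also have "\<dots> \<in> rational_functions"
    unfolding th using x Q
    by (intro rational_functions_add rational_functions_mult rational_functions_uminus
        rational_functions_inverse fls_of_poly_in) (auto intro: rational_functionsI)
  finally show ?thesis .
qed

lemma rational_functions_common_denominator:
  assumes "finite I" "\<And>i. c i \<in> rational_functions"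
  shows "\<exists>Q P. Q \<noteq> 0 \<and> (\<forall>i\<in>I. c i * fls_of_poly Q = fls_of_poly (P i))"
  using assms(1)
proof (induction I)
  case empty
  show ?case by (intro exI[of _ 1]) auto
next
  case (insert k I)
  then obtain Q P where QP: "Q \<noteq> 0" "\<forall>i\<in>I. c i * fls_of_poly Q = fls_of_poly (P i)" by blast
  obtain R T where RT: "T \<noteq> 0" "c k = fls_of_poly R / fls_of_poly T"
    using assms(2)[of k] by (rule rational_functionsE)
  have "c k * fls_of_poly (Q * T) = fls_of_poly (R * Q)"
    using RT by (simp add: fls_of_poly_simps field_simps fls_of_poly_eq_0_iff)
  moreover have "c i * fls_of_poly (Q * T) = fls_of_poly (P i * T)" if "i \<in> I" for i
    using QP(2) that by (simp add: fls_of_poly_simps flip: mult.assoc)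
  ultimately show ?case
    using QP(1) RT(1) by (intro exI[of _ "Q * T"] exI[of _ "\<lambda>i. if i = k then R * Q else P i * T"]) auto
qed

section \<open>From linear dependence to a polynomial recurrence\<close>

lemma theta_iterate:
  fixes a :: "nat \<Rightarrow> 'a::field"
  shows "(theta ^^ i) (fps_to_fls (Abs_fps a)) = fps_to_fls (Abs_fps (\<lambda>n. of_nat n ^ i * a n))"
proof (induction i)
  case (Suc i)
  have "theta (fps_to_fls F) = fps_to_fls (Abs_fps (\<lambda>n. of_nat n * F $ n))" for F :: "'a fps"
  proof -
    have "fps_X * fps_deriv F = Abs_fps (\<lambda>n. of_nat n * F $ n)"
      by (rule fps_ext) (simp split: nat.split)
    then show ?thesis
      by (simp add: theta_def fls_deriv_fps_to_fls flip: fps_X_to_fls fls_times_fps_to_fls)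
  qed
  then show ?case by (simp add: Suc mult.assoc)
qed auto

text \<open>Clear denominators and compare coefficients of \<open>t^n\<close>: the i-th iterate
  contributes the factor \<open>(n - j)^i\<close>, and the powers of \<open>t\<close> in the cleared
  coefficients contribute the shifts \<open>j\<close>.\<close>

lemma dependent_iterates_recurrence:
  fixes a :: "nat \<Rightarrow> 'a::field"
  assumes "\<And>i. c i \<in> rational_functions" "i0 \<le> d" "c i0 \<noteq> 0"
    and "(\<Sum>i\<le>d. c i * (theta ^^ i) (fps_to_fls (Abs_fps a))) = 0"
  shows "\<exists>J q. (\<exists>j\<le>J. q j \<noteq> 0) \<and>
    (\<forall>n\<ge>J. (\<Sum>j\<le>J. poly (q j) (of_nat (n - j)) * a (n - j)) = 0)"
proof -
  obtain Q P where QP: "Q \<noteq> 0" "\<forall>i\<in>{..d}. c i * fls_of_poly Q = fls_of_poly (P i)"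
    using rational_functions_common_denominator[of "{..d}" c] assms(1) by blast
  have "fls_of_poly (P i0) \<noteq> 0"
    using assms(2,3) QP by (metis atMost_iff mult_eq_0_iff fls_of_poly_eq_0_iff)
  then have Pi0: "P i0 \<noteq> 0" by auto
  let ?A = "\<lambda>i. Abs_fps (\<lambda>n. of_nat n ^ i * a n)"
  define J where "J = (MAX i\<in>{..d}. Polynomial.degree (P i))"
  have J: "Polynomial.degree (P i) \<le> J" if "i \<le> d" for i
    unfolding J_def using that by (intro Max_ge) auto
  \<comment> \<open>Transposition: the coefficient of \<open>t^j\<close> in \<open>P i\<close>
    becomes the coefficient of degree \<open>i\<close> in \<open>q j\<close>.\<close>
  define q where "q j = (\<Sum>i\<le>d. Polynomial.monom (Polynomial.coeff (P i) j) i)" for j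
  have cq: "Polynomial.coeff (q j) i = (if i \<le> d then Polynomial.coeff (P i) j else 0)" for i j
    by (auto simp: q_def coeff_sum)
  have "(\<Sum>i\<le>d. c i * (theta ^^ i) (fps_to_fls (Abs_fps a)) * fls_of_poly Q) = 0"
    using assms(4) by (simp flip: sum_distrib_right)
  also have "(\<Sum>i\<le>d. c i * (theta ^^ i) (fps_to_fls (Abs_fps a)) * fls_of_poly Q) =
     (\<Sum>i\<le>d. fps_to_fls (fps_of_poly (P i) * ?A i))"
    using QP(2) by (intro sum.cong) (auto simp: theta_iterate fls_times_fps_to_fls mult_ac)
  also have "\<dots> = fps_to_fls (\<Sum>i\<le>d. fps_of_poly (P i) * ?A i)"
    by (induction d) auto
  finally have 0: "(\<Sum>i\<le>d. fps_of_poly (P i) * ?A i) = 0" by simp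
  have "(\<Sum>j\<le>J. poly (q j) (of_nat (n - j)) * a (n - j)) = 0" if "n \<ge> J" for n
  proof -
    have "0 = (\<Sum>i\<le>d. (fps_of_poly (P i) * ?A i) $ n)"
      using arg_cong[OF 0, of "\<lambda>F. F $ n"] by (simp add: fps_sum_nth)
    also have "\<dots> = (\<Sum>i\<le>d. \<Sum>j\<le>J. Polynomial.coeff (P i) j * (of_nat (n - j) ^ i * a (n - j)))"
    proof (intro sum.cong refl)
      fix i assume "i \<in> {..d}"
      then show "(fps_of_poly (P i) * ?A i) $ n =
          (\<Sum>j\<le>J. Polynomial.coeff (P i) j * (of_nat (n - j) ^ i * a (n - j)))"
        unfolding fps_mult_nth using that J[of i]
        by (intro sum.mono_neutral_cong_right) (auto simp: coeff_eq_0)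
    qed
    also have "\<dots> = (\<Sum>j\<le>J. poly (q j) (of_nat (n - j)) * a (n - j))"
      by (subst sum.swap) (simp add: q_def poly_sum poly_monom sum_distrib_right mult.assoc)
    finally show ?thesis by simp
  qed
  \<comment> \<open>The leading coefficient of \<open>P i0\<close> reappears in \<open>q j\<close>
    for \<open>j\<close> the degree of \<open>P i0\<close>.\<close>
  moreover have "\<exists>j\<le>J. q j \<noteq> 0"
    using cq[of "Polynomial.degree (P i0)" i0] Pi0 J[OF assms(2)] assms(2)
    by (intro exI[of _ "Polynomial.degree (P i0)"]) auto
  ultimately show ?thesis by blast
qed

subsection \<open>Fixed points\<close>

text \<open>Split off a linear factor, \<open>P = (x - a) * Q\<close>. From
  \<open>P' = Q + (x - a) * Q'\<close>, the root \<open>a\<close> is not a root of \<open>Q\<close>,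
  and \<open>Q\<close> inherits simplicity of its roots.\<close>

lemma card_roots_eq_degree:
  fixes P :: "'a::alg_closed_field poly"
  assumes "P \<noteq> 0" "\<And>x. poly P x = 0 \<Longrightarrow> poly (pderiv P) x \<noteq> 0"
  shows "card {x. poly P x = 0} = Polynomial.degree P"
  using assms
proof (induction "Polynomial.degree P" arbitrary: P)
  case 0
  then obtain c where "P = [:c:]" by (metis degree_eq_zeroE)
  with 0 show ?case by auto
next
  case (Suc n)
  then obtain a where a: "poly P a = 0"
    using alg_closed_imp_poly_has_root[of P] by auto
  then obtain Q where Q: "P = [:-a, 1:] * Q"
    by (metis poly_eq_0_iff_dvd dvdE)
  have Q0: "Q \<noteq> 0" using Suc.prems(1) Q by auto
  have deg: "Polynomial.degree P = Suc (Polynomial.degree Q)"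
    unfolding Q using Q0 by (subst degree_mult_eq) auto
  have d: "poly (pderiv P) x = poly Q x + (x - a) * poly (pderiv Q) x" for x
    unfolding Q pderiv_mult by (simp add: pderiv_pCons algebra_simps)
  have Qa: "poly Q a \<noteq> 0"
    using Suc.prems(2)[OF a] d[of a] by simp
  have "poly (pderiv Q) x \<noteq> 0" if "poly Q x = 0" for x
    using Suc.prems(2)[of x] d[of x] that Q by auto
  then have "card {x. poly Q x = 0} = Polynomial.degree Q"
    using Suc.hyps deg Q0 by auto
  moreover have "{x. poly P x = 0} = insert a {x. poly Q x = 0}"
    by (auto simp: Q)
  ultimately show ?case
    using Qa poly_roots_finite[OF Q0] deg by simp
qed

lemma num_fixed_points_inseparable:
  fixes g :: "'a::alg_closed_field poly"
  assumes f: "f = pcompose g (Polynomial.monom 1 CHAR('a))"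
    and "Polynomial.degree f \<ge> 2" "n \<ge> 1"
  shows "num_fixed_points f n = Polynomial.degree f ^ n"
proof -
  define F where "F k = (pcompose f ^^ k) [:0, 1:]" for k
  have iter: "poly (F k) x = (poly f ^^ k) x" for k x
    by (induction k) (auto simp: F_def poly_pcompose)
  have deg: "Polynomial.degree (F k) = Polynomial.degree f ^ k" for k
    by (induction k) (auto simp: F_def degree_pcompose)
  have "pderiv f = 0"
    by (simp add: f pderiv_pcompose pderiv_monom)
  then have "pderiv (F n) = 0"
    using \<open>n \<ge> 1\<close> by (cases n) (auto simp: F_def pderiv_pcompose)
  then have pd: "pderiv (F n - [:0, 1:]) = [:- 1:]"
    by (simp add: pderiv_diff pderiv_pCons)
  \<comment> \<open>With degree at least 2, subtracting \<open>x\<close> leaves the leading term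
    alone.\<close>
  have "2 \<le> Polynomial.degree f ^ n"
    using assms(2,3) by (metis order_trans self_le_power zero_less_one less_le_trans one_le_numeral)
  then have deg': "Polynomial.degree (F n - [:0, 1:]) = Polynomial.degree f ^ n"
    unfolding diff_conv_add_uminus by (subst degree_add_eq_left) (auto simp: deg)
  have "card {x. poly (F n - [:0, 1:]) x = 0} = Polynomial.degree f ^ n"
    unfolding deg'[symmetric]
  proof (rule card_roots_eq_degree)
    show "F n - [:0, 1:] \<noteq> 0" using pd by (metis pderiv_0 neg_equal_0_iff_equal pCons_eq_0_iff zero_neq_one)
  qed (simp add: pd)
  then show ?thesis
    by (simp add: num_fixed_points_def iter)
qed

text \<open>The derivative \<open>r * x^(r - 1)\<close> of \<open>x^r - 1\<close> vanishes only at 0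
  if at all, and 0 is not a root.\<close>

lemma card_roots_of_unity_alg_closed:
  assumes "of_nat r \<noteq> (0 :: 'a::alg_closed_field)"
  shows "card {x::'a. x ^ r = 1} = r"
proof -
  have r: "r > 0" using assms by (cases r) auto
  let ?P = "Polynomial.monom (1::'a) r - 1"
  have deg: "Polynomial.degree ?P = r"
    using r degree_add_eq_left[of "-1" "Polynomial.monom (1::'a) r"] by (simp add: degree_monom_eq)
  have "card {x. poly ?P x = 0} = Polynomial.degree ?P"
  proof (rule card_roots_eq_degree)
    show "?P \<noteq> 0" using deg r by auto
    fix x :: 'a assume "poly ?P x = 0"
    then have "x ^ r = 1" by (simp add: poly_monom)
    then have "x \<noteq> 0" using r by (auto simp: power_0_left)
    then show "poly (pderiv ?P) x \<noteq> 0"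
      using assms by (simp add: pderiv_diff pderiv_monom poly_monom)
  qed
  then show ?thesis by (simp add: deg poly_monom)
qed

text \<open>Write \<open>m^n - 1 = p^v * r\<close> with \<open>r\<close> prime to \<open>p\<close>.
  Frobenius is injective, so the nonzero fixed points are exactly the r-th roots of unity; the extra
  1 counts the point 0.\<close>

lemma num_fixed_points_monom:
  fixes p m n :: nat
  assumes p: "Factorial_Ring.prime p" and char: "CHAR('a::alg_closed_field) = p"
    and m: "m \<ge> 2" and n: "n \<ge> 1"
  shows "of_nat (num_fixed_points (Polynomial.monom 1 m :: 'a poly) n) =
    (1 + (of_nat m ^ n - 1) / of_nat p ^ multiplicity (int p) (int m ^ n - 1) :: rat)"
proof -
  let ?v = "multiplicity (int p) (int m ^ n - 1)"
  have mn: "m ^ n \<ge> 2"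
    using m n by (metis order_trans self_le_power zero_less_one less_le_trans one_le_numeral)
  then have gt: "int m ^ n - 1 > 0"
    by (metis diff_gt_0_iff_gt of_nat_power of_nat_1 of_nat_less_iff one_less_numeral_iff
        semiring_norm(76) less_le_trans)
  obtain r' where r': "int m ^ n - 1 = int p ^ ?v * r'" "\<not> int p dvd r'"
    using multiplicity_decompose'[of "int m ^ n - 1" "int p"] gt p
    by (metis less_irrefl not_prime_unit prime_nat_int_transfer)
  have pos: "int p ^ ?v > 0"
    using p prime_gt_0_nat by simp
  have "r' > 0"
    using gt r'(1) pos by (metis zero_less_mult_pos)
  then obtain r where r: "r' = int r" "r > 0"
    by (metis zero_less_imp_eq_int)
  have "int (m ^ n) = int (1 + p ^ ?v * r)"
    using r'(1) r by simp
  then have eq: "m ^ n = 1 + p ^ ?v * r"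
    by (simp only: of_nat_eq_iff)
  have "\<not> p dvd r"
    using r'(2) r by simp
  then have r_nz: "of_nat r \<noteq> (0::'a)"
    by (simp add: of_nat_eq_0_iff_char_dvd char)
  have iter: "(poly (Polynomial.monom 1 m) ^^ k) x = x ^ (m ^ k)" for k and x :: 'a
    by (induction k) (auto simp: poly_monom power_mult[symmetric] mult.commute)
  have frob: "x ^ (p ^ ?v) = 1 \<longleftrightarrow> x = 1" for x :: 'a
  proof
    assume *: "x ^ (p ^ ?v) = 1"
    have "((x - 1) + 1) ^ (p ^ ?v) = (x - 1) ^ (p ^ ?v) + 1 ^ (p ^ ?v)"
      by (rule freshmans_dream') (use p char in auto)
    then show "x = 1" using * by simp
  qed auto
  have "x ^ (m ^ n) = x \<longleftrightarrow> x = 0 \<or> x ^ r = 1" for x :: 'a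
    using frob[of "x ^ r"] mn by (auto simp: eq power_mult[symmetric] mult.commute)
  then have "{x::'a. (poly (Polynomial.monom 1 m) ^^ n) x = x} = insert 0 {x. x ^ r = 1}"
    by (auto simp: iter)
  moreover have "finite {x::'a. x ^ r = 1}"
    using card_roots_of_unity_alg_closed[OF r_nz] r by (metis card.infinite less_irrefl)
  ultimately have "num_fixed_points (Polynomial.monom 1 m :: 'a poly) n = 1 + r"
    using card_roots_of_unity_alg_closed[OF r_nz] r by (simp add: num_fixed_points_def power_0_left)
  moreover have "(of_nat m ^ n :: rat) = 1 + of_nat p ^ ?v * of_nat r"
    using arg_cong[OF eq, of "of_nat :: nat \<Rightarrow> rat"] by simp
  ultimately show ?thesis
    using p prime_gt_0_nat by simp
qed

subsection \<open>Valuations of \<open>m^n - 1\<close>\<close>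

lemma exponential_polynomial_eq_0:
  fixes A B :: "'a::linordered_field poly"
  assumes "D > 1" "\<And>z. z \<ge> z0 \<Longrightarrow> poly A (of_nat z) + D ^ z * poly B (of_nat z) = 0"
  shows "B = 0"
  using assms(2)
\<comment> \<open>The measure is degree plus one, with 0 for the zero polynomial, so that it still
  drops when differencing kills a constant.\<close>
proof (induction "if A = 0 then 0 else Suc (Polynomial.degree A)" arbitrary: A B rule: less_induct)
  case less
  \<comment> \<open>Taking differences lowers the degree of \<open>A\<close> and maps \<open>B\<close> to \<open>D B(z + 1) - B(z)\<close>,
    whose leading coefficient is \<open>D - 1\<close> times that of \<open>B\<close>.\<close>
  show ?case
  proof (cases "A = 0")
    case True
    then have "of_nat ` {z0..} \<subseteq> {x. poly B x = 0}"
      using less.prems \<open>D > 1\<close> by auto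
    moreover have "infinite (of_nat ` {z0..} :: 'a set)"
      by (subst finite_image_iff) (auto simp: inj_on_def infinite_Ici)
    ultimately show ?thesis
      using poly_roots_finite finite_subset by blast
  next
    case False
    define A' where "A' = pcompose A [:1, 1:] - A"
    define B' where "B' = smult D (pcompose B [:1, 1:]) - B"
    have top: "Polynomial.coeff (pcompose Q [:1, 1:]) (Polynomial.degree Q) = lead_coeff Q"
      for Q :: "'a poly"
      using lead_coeff_comp[of "[:1, 1:]" Q] by (simp add: degree_pcompose)
    have "A' = 0 \<or> Polynomial.degree A' < Polynomial.degree A"
    proof (rule disjCI)
      assume "\<not> Polynomial.degree A' < Polynomial.degree A"
      moreover have "Polynomial.degree A' \<le> Polynomial.degree A"
        unfolding A'_def by (intro degree_diff_le) (auto simp: degree_pcompose)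
      ultimately have "lead_coeff A' = 0"
        using top[of A] by (simp add: A'_def)
      then show "A' = 0" by simp
    qed
    then have "(if A' = 0 then 0 else Suc (Polynomial.degree A')) <
        (if A = 0 then 0 else Suc (Polynomial.degree A))"
      using False by auto
    moreover have "poly A' (of_nat z) + D ^ z * poly B' (of_nat z) = 0" if "z \<ge> z0" for z
      using less.prems[OF that] less.prems[of "Suc z"] that
      by (simp add: A'_def B'_def poly_pcompose algebra_simps)
    ultimately have "B' = 0"
      using less.hyps by blast
    then have "Polynomial.coeff B' (Polynomial.degree B) = 0" by simp
    then have "(D - 1) * lead_coeff B = 0"
      using top[of B] by (simp add: B'_def algebra_simps)
    then show ?thesis using \<open>D > 1\<close> by simp
  qed
qed

text \<open>Ultrametric principle: a summand of larger valuation does not affect the valuation of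
  the sum.\<close>

lemma multiplicity_add_eq_right:
  fixes p x y :: int
  assumes "p ^ Suc n dvd x" "multiplicity p y \<le> n" "y \<noteq> 0" "Factorial_Ring.prime p"
  shows "multiplicity p (x + y) = multiplicity p y"
proof (rule multiplicity_eqI)
  let ?k = "multiplicity p y"
  have x: "p ^ ?k dvd x" "p ^ Suc ?k dvd x"
    using assms(1,2) by (meson dvd_trans le_imp_power_dvd le_SucI Suc_le_mono)+
  show "p ^ ?k dvd x + y"
    using x multiplicity_dvd by (intro dvd_add)
  show "\<not> p ^ Suc ?k dvd x + y"
    using x assms(3,4) by (metis dvd_add_right_iff multiplicity_geI not_less_eq_eq order_refl
        not_prime_unit)
qed

text \<open>The cofactor of \<open>y - 1\<close> in \<open>y^w - 1\<close> is a geometric sum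
  congruent to \<open>w\<close> modulo \<open>p\<close>, hence prime to \<open>p\<close>.\<close>

lemma multiplicity_power_minus_one:
  fixes p y :: int
  assumes "Factorial_Ring.prime p" "p dvd y - 1" "\<not> p dvd int w"
  shows "multiplicity p (y ^ w - 1) = multiplicity p (y - 1)"
proof -
  have "[y ^ i = 1] (mod p)" for i
    using cong_pow[of y 1 p i] assms(2) by (simp add: cong_iff_dvd_diff)
  then have "[(\<Sum>i<w. y ^ i) = (\<Sum>i<w. 1)] (mod p)"
    by (intro cong_sum)
  then have "\<not> p dvd (\<Sum>i<w. y ^ i)"
    using assms(3) by (simp add: cong_dvd_iff)
  then show ?thesis
    using multiplicity_prime_elem_times_other[OF prime_imp_prime_elem[OF assms(1)],
        of "\<Sum>i<w. y ^ i" "y - 1"]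
    by (simp add: power_diff_1_eq mult.commute)
qed

section \<open>Ruling out polynomial recurrences\<close>

lemma no_polynomial_recurrence:
  fixes p m :: nat and q :: "nat \<Rightarrow> rat poly"
  defines "\<nu> \<equiv> \<lambda>n. multiplicity (int p) (int m ^ n - 1)"
  defines "a \<equiv> \<lambda>n. 1 + (of_nat m ^ n - 1) / of_nat p ^ \<nu> n :: rat"
  assumes p: "Factorial_Ring.prime p" and m: "m \<ge> 2" "\<not> p dvd m"
    and rec: "\<And>n. n > J \<Longrightarrow> (\<Sum>j\<le>J. poly (q j) (of_nat (n - j)) * a (n - j)) = 0"
    and j0: "j0 \<le> J"
  shows "q j0 = 0"
proof -
  have pi: "Factorial_Ring.prime (int p)" using p by simp
  have p2: "p \<ge> 2" using p prime_ge_2_nat by blast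
  have m_pos: "int m ^ d - 1 > 0" if "d > 0" for d
    using one_less_power[of "int m" d] m that by simp
  have pm: "\<not> int p dvd int m ^ d" for d
    using pi m(2) by (simp add: prime_dvd_power_iff int_dvd_int_iff prime_dvd_power) 
      (metis int_dvd_int_iff of_nat_power p prime_dvd_power)
  \<comment> \<open>From \<open>N0\<close> on, \<open>p^(N + 1)\<close> exceeds the power of
    \<open>p\<close> in every \<open>m^d - 1\<close> with \<open>0 < d \<le> J\<close>; the entry at
    \<open>d = 0\<close> is the multiplicity of 0, which is 0 by convention.\<close>
  define N0 where "N0 = (MAX d\<in>{..J}. \<nu> d)"
  have N0: "\<nu> d \<le> N0" if "d \<le> J" for d
    unfolding N0_def using that by (intro Max_ge) auto
  \<comment> \<open>By Euler's theorem, \<open>m^(M N)\<close> is 1 modulo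
    \<open>p^(N + 1)\<close>.\<close>
  define M where "M N = totient (p ^ Suc N)" for N
  define s where "s N = \<nu> (M N)" for N
  have M_pos: "M N > 0" for N
    using p2 by (simp add: M_def)
  have cop: "coprime m (p ^ Suc N)" for N
    using p m(2) by (metis coprime_commute coprime_power_right_iff prime_imp_coprime)
  have M_dvd: "int p ^ Suc N dvd int m ^ M N - 1" for N
  proof -
    have "[m ^ M N = 1] (mod p ^ Suc N)"
      unfolding M_def by (rule euler_theorem[OF cop])
    then have "[int (m ^ M N) = int 1] (mod int (p ^ Suc N))"
      by (simp only: cong_int_iff)
    then show ?thesis by (simp add: cong_iff_dvd_diff)
  qed
  have s_gt: "s N > N" for N
    unfolding s_def \<nu>_def using multiplicity_geI[OF _ _ M_dvd] m_pos[OF M_pos, of N] pi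
    by (metis Suc_le_eq less_irrefl not_prime_unit)
  have pow_L_dvd: "int p ^ Suc N dvd int m ^ (M N * w) - 1" for N w
    using M_dvd[of N] by (metis dvd_mult2 power_diff_1_eq power_mult)
  have nu_L: "\<nu> (M N * w) = s N" if "\<not> p dvd w" for N w
    unfolding \<nu>_def s_def power_mult using M_dvd[of N] pi that
    by (intro multiplicity_power_minus_one) (auto dest: dvd_mult_left)
  \<comment> \<open>In \<open>m^d * (m^L - 1) + (m^d - 1)\<close> the first summand is divisible by
    \<open>p^(N + 1)\<close>, the second only by a power of exponent at most
    \<open>N\<close>.\<close>
  have nu_add: "\<nu> (M N * w + d) = \<nu> d" if "d > 0" "d \<le> J" "N \<ge> N0" for N w d
  proof -
    have "int m ^ (M N * w + d) - 1 = int m ^ d * (int m ^ (M N * w) - 1) + (int m ^ d - 1)"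
      by (simp add: algebra_simps power_add)
    moreover have "multiplicity (int p) (int m ^ d - 1) \<le> N"
      using N0[OF that(2)] that(3) by (simp add: \<nu>_def)
    ultimately show ?thesis
      unfolding \<nu>_def using multiplicity_add_eq_right[OF dvd_mult[OF pow_L_dvd[of N w]]]
        m_pos[OF that(1)] pi by (metis less_irrefl)
  qed
  \<comment> \<open>Multiplying by \<open>m^d\<close>, which is prime to \<open>p\<close>, avoids
    negative exponents and reduces to the same comparison.\<close>
  have nu_diff: "\<nu> (M N * w - d) = \<nu> d" if "d > 0" "d \<le> J" "N \<ge> N0" "M N * w \<ge> d" for N w d
  proof -
    have "int m ^ d * (int m ^ (M N * w - d) - 1) = int m ^ (M N * w) - int m ^ d"
      using that(4) by (simp add: algebra_simps flip: power_add)
    also have "\<dots> = - (- (int m ^ (M N * w) - 1) + (int m ^ d - 1))"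
      by simp
    finally have eq: "int m ^ d * (int m ^ (M N * w - d) - 1) =
        - 1 * (- (int m ^ (M N * w) - 1) + (int m ^ d - 1))" by simp
    have "multiplicity (int p) (int m ^ d * (int m ^ (M N * w - d) - 1)) =
        multiplicity (int p) (- (int m ^ (M N * w) - 1) + (int m ^ d - 1))"
      unfolding eq by (rule multiplicity_times_unit_right) simp
    moreover have "int p ^ Suc N dvd - (int m ^ (M N * w) - 1)"
      by (subst dvd_minus_iff) (rule pow_L_dvd)
    moreover have "multiplicity (int p) (int m ^ d - 1) \<le> N"
      using N0[OF that(2)] that(3) by (simp add: \<nu>_def)
    ultimately show ?thesis
      unfolding \<nu>_def using multiplicity_add_eq_right[of "int p" N "- (int m ^ (M N * w) - 1)" "int m ^ d - 1"]
        m_pos[OF that(1)] pi multiplicity_prime_elem_times_other[of "int p" "int m ^ d"] pm[of d]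
      by (simp add: prime_imp_prime_elem)
  qed
  \<comment> \<open>\<open>e N j\<close> is the valuation at index \<open>j0 + L - j\<close>,
    \<open>Q j\<close> rewrites \<open>q j\<close> in terms of \<open>L\<close>, and
    \<open>c j\<close> is \<open>m^(j0 - j)\<close>, a quotient because the exponent may be
    negative. \<open>A\<close> collects the terms free of \<open>m^L\<close>, \<open>B\<close> those
    multiplied by it.\<close>
  define e where "e N j = (if j = j0 then s N else \<nu> (if j < j0 then j0 - j else j - j0))" for N j
  define Q where "Q j = pcompose (q j) [:of_nat j0 - of_nat j, 1:]" for j
  define c where "c j = (of_nat m ^ j0 / of_nat m ^ j :: rat)" for j
  define A where "A N = (\<Sum>j\<le>J. smult (1 - 1 / of_nat p ^ e N j) (Q j))" for N
  define B where "B N = (\<Sum>j\<le>J. smult (c j / of_nat p ^ e N j) (Q j))" for N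
  have m0: "(of_nat m :: rat) \<noteq> 0" using m by auto
  \<comment> \<open>At \<open>n = j0 + M N * w\<close> only the valuation belonging to \<open>j0\<close> depends on \<open>N\<close>, so
    the recurrence reads \<open>A(L) + m^L B(L) = 0\<close> with \<open>L = M N * w\<close>.\<close>
  have key: "poly (A N) (of_nat (M N * w)) + of_nat m ^ (M N * w) * poly (B N) (of_nat (M N * w)) = 0"
    if "N \<ge> N0" "\<not> p dvd w" "M N * w > J" for N w
  proof -
    let ?L = "M N * w"
    have "poly (q j) (of_nat (j0 + ?L - j)) * a (j0 + ?L - j) =
        (1 - 1 / of_nat p ^ e N j) * poly (Q j) (of_nat ?L) +
        of_nat m ^ ?L * (c j / of_nat p ^ e N j * poly (Q j) (of_nat ?L))" if "j \<le> J" for j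
    proof -
      have le: "j \<le> j0 + ?L" using that \<open>?L > J\<close> by simp
      have "\<nu> (j0 + ?L - j) = e N j"
      proof -
        consider "j = j0" | "j < j0" | "j > j0" by linarith
        then show ?thesis
        proof cases
          case 1
          then show ?thesis using nu_L[OF \<open>\<not> p dvd w\<close>] by (simp add: e_def)
        next
          case 2
          then have "j0 + ?L - j = ?L + (j0 - j)" by simp
          then show ?thesis using nu_add[of "j0 - j" N w] 2 j0 \<open>N \<ge> N0\<close> by (simp add: e_def)
        next
          case 3
          then have "j0 + ?L - j = ?L - (j - j0)" by simp
          then show ?thesis using nu_diff[of "j - j0" N w] 3 that \<open>?L > J\<close> \<open>N \<ge> N0\<close>
            by (simp add: e_def)
        qed
      qed
      moreover have "(of_nat m :: rat) ^ (j0 + ?L - j) = of_nat m ^ ?L * c j"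
        using le m0 by (simp add: c_def power_diff power_add)
      moreover have "poly (q j) (of_nat (j0 + ?L - j)) = poly (Q j) (of_nat ?L)"
        using le by (simp add: Q_def poly_pcompose of_nat_diff algebra_simps)
      ultimately show ?thesis
        by (simp add: a_def algebra_simps diff_divide_distrib)
    qed
    then have "(\<Sum>j\<le>J. poly (q j) (of_nat (j0 + ?L - j)) * a (j0 + ?L - j)) =
        poly (A N) (of_nat ?L) + of_nat m ^ ?L * poly (B N) (of_nat ?L)"
      by (simp add: A_def B_def poly_sum sum.distrib sum_distrib_left)
    then show ?thesis
      using rec[of "j0 + ?L"] \<open>?L > J\<close> by simp
  qed
  have B0: "B N = 0" if "N \<ge> N0" for N
  proof -
    \<comment> \<open>Taking \<open>w = 1 + p * z\<close> keeps \<open>w\<close> prime to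
      \<open>p\<close>; then \<open>L\<close> is the linear polynomial \<open>?l\<close> in
      \<open>z\<close>, and \<open>m^L = m^(M N) * ?D^z\<close>.\<close>
    let ?l = "[:of_nat (M N), of_nat (M N * p):] :: rat poly"
    let ?D = "of_nat m ^ (M N * p) :: rat"
    have "smult (of_nat m ^ M N) (pcompose (B N) ?l) = 0"
    proof (rule exponential_polynomial_eq_0)
      show "?D > 1"
        using m M_pos[of N] p2 by (intro one_less_power) auto
      fix z :: nat assume z: "z \<ge> Suc J"
      let ?w = "1 + p * z"
      have "\<not> p dvd ?w"
        using p2 by (metis dvd_add_left_iff dvd_triv_left nat_dvd_1_iff_1 not_numeral_le_zero
            one_le_numeral numeral_le_one_iff semiring_norm(69))
      moreover have "M N * ?w \<ge> 1 * (1 * z)"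
        using M_pos[of N] p2 by (intro mult_le_mono trans_le_add2) auto
      ultimately show "poly (pcompose (A N) ?l) (of_nat z) +
          ?D ^ z * poly (smult (of_nat m ^ M N) (pcompose (B N) ?l)) (of_nat z) = 0"
        using key[OF that, of ?w] z
        by (simp add: poly_pcompose algebra_simps power_add flip: power_mult)
    qed
    then have "pcompose (B N) ?l = 0" using m0 by simp
    moreover have "Polynomial.degree ?l > 0"
      using M_pos[of N] p2 by simp
    ultimately show ?thesis by (simp add: pcompose_eq_0)
  qed
  \<comment> \<open>Since \<open>s N1 > N1\<close>, this choice yields \<open>s N1 > s N0\<close>
    while keeping \<open>N1 \<ge> N0\<close>.\<close>
  define N1 where "N1 = N0 + s N0"
  have lt: "s N0 < s N1"
    using s_gt[of N1] by (simp add: N1_def)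
  have "B N0 - B N1 = (\<Sum>j\<le>J. smult (c j / of_nat p ^ e N0 j - c j / of_nat p ^ e N1 j) (Q j))"
    by (simp add: B_def sum_subtractf[symmetric] smult_diff_left)
  \<comment> \<open>Only \<open>e N j0\<close> varies with \<open>N\<close>, so all other terms
    cancel.\<close>
  also have "\<dots> = (\<Sum>j\<in>{j0}. smult (c j / of_nat p ^ e N0 j - c j / of_nat p ^ e N1 j) (Q j))"
    using j0 by (intro sum.mono_neutral_right) (auto simp: e_def)
  also have "\<dots> = smult (1 / of_nat p ^ s N0 - 1 / of_nat p ^ s N1) (q j0)"
    using m0 by (simp add: e_def c_def Q_def)
  finally have "smult (1 / of_nat p ^ s N0 - 1 / of_nat p ^ s N1) (q j0) = 0"
    using B0[of N0] B0[of N1] by (simp add: N1_def)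
  moreover have "(of_nat p :: rat) ^ s N0 < of_nat p ^ s N1"
    using lt p2 by (intro power_strict_increasing) auto
  then have "(1 / of_nat p ^ s N0 - 1 / of_nat p ^ s N1 :: rat) \<noteq> 0"
    using p2 by (simp add: field_simps)
  ultimately show ?thesis by simp
qed

subsection \<open>The zeta function\<close>

definition log_zeta :: "'a::field poly \<Rightarrow> rat fps" where
  "log_zeta f = Abs_fps (\<lambda>n. if n = 0 then 0 else of_nat (num_fixed_points f n) / of_nat n)"

text \<open>The chain rule for the exponential, valid because \<open>log_zeta f\<close> has zero
  constant term.\<close>

lemma deriv_zeta: "fps_deriv (artin_mazur_zeta f) = artin_mazur_zeta f * fps_deriv (log_zeta f)"
proof -
  have eq: "artin_mazur_zeta f = fps_exp 1 oo log_zeta f"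
    by (simp add: artin_mazur_zeta_def log_zeta_def)
  show ?thesis
    unfolding eq by (subst fps_compose_deriv) (simp_all add: log_zeta_def)
qed

lemma zeta_nth_0: "artin_mazur_zeta f $ 0 = 1"
  by (simp add: artin_mazur_zeta_def)

text \<open>Applying \<open>theta\<close> to the exponent cancels the denominators
  \<open>n\<close>.\<close>

lemma log_derivative_zeta:
  "theta (fps_to_fls (artin_mazur_zeta f)) / fps_to_fls (artin_mazur_zeta f) =
    fps_to_fls (Abs_fps (\<lambda>n. if n = 0 then 0 else of_nat (num_fixed_points f n)))"
proof -
  have nz: "artin_mazur_zeta f \<noteq> 0"
    using zeta_nth_0[of f] by auto
  have "fps_X * fps_deriv (log_zeta f) = Abs_fps (\<lambda>n. if n = 0 then 0 else of_nat (num_fixed_points f n))"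
    by (rule fps_ext) (simp add: log_zeta_def split: nat.split)
  moreover have "theta (fps_to_fls (artin_mazur_zeta f)) =
      fps_to_fls (artin_mazur_zeta f) * fps_to_fls (fps_X * fps_deriv (log_zeta f))"
    by (simp add: theta_def fls_deriv_fps_to_fls deriv_zeta mult_ac
        flip: fps_X_to_fls fls_times_fps_to_fls)
  ultimately show ?thesis
    using nz by simp
qed

text \<open>The logarithmic derivative is \<open>d / (1 - d t)\<close>, so zeta times
  \<open>1 - d t\<close> has derivative zero and equals its constant term 1.\<close>

lemma zeta_rational:
  assumes "\<And>n. n \<ge> 1 \<Longrightarrow> num_fixed_points f n = d ^ n"
  shows "fps_to_fls (artin_mazur_zeta f) \<in> rational_functions"
proof -
  let ?z = "artin_mazur_zeta f" and ?l = "1 - fps_const (of_nat d) * fps_X :: rat fps"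
  have "fps_deriv (log_zeta f) * ?l = fps_const (of_nat d)"
  proof (rule fps_ext)
    fix n
    have "(fps_deriv (log_zeta f) * ?l) $ n = fps_deriv (log_zeta f) $ n -
        of_nat d * (fps_X * fps_deriv (log_zeta f)) $ n"
      by (simp add: algebra_simps)
    then show "(fps_deriv (log_zeta f) * ?l) $ n = fps_const (of_nat d) $ n"
      by (cases n) (simp_all add: log_zeta_def assms del: of_nat_Suc)
  qed
  moreover have "fps_deriv (?z * ?l) = ?z * (fps_deriv (log_zeta f) * ?l - fps_const (of_nat d))"
    by (simp add: deriv_zeta algebra_simps)
  ultimately have "fps_deriv (?z * ?l) = 0" by simp
  then have "?z * ?l = fps_const ((?z * ?l) $ 0)"
    by (simp only: fps_deriv_eq_0_iff)
  also have "\<dots> = 1"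
    by (simp add: zeta_nth_0)
  finally have "?z * fps_of_poly [:1, - of_nat d:] = 1"
    by (simp add: fps_of_poly_linear' flip: fps_const_neg)
  then have "fps_to_fls ?z * fls_of_poly [:1, - of_nat d:] = fls_of_poly 1"
    by (simp flip: fls_times_fps_to_fls)
  moreover have "[:1, - of_nat d:] \<noteq> (0 :: rat poly)" by simp
  ultimately show ?thesis
    by (intro rational_functionsI[of "[:1, - of_nat d:]" _ 1])
      (auto simp: eq_divide_eq fls_of_poly_eq_0_iff simp del: fps_of_poly_1)
qed

lemma zeta_algebraic_recurrence:
  assumes "algebraic_over rational_functions (fps_to_fls (artin_mazur_zeta f))"
  shows "\<exists>J q. (\<exists>j\<le>J. q j \<noteq> 0) \<and>
    (\<forall>n>J. (\<Sum>j\<le>J. poly (q j) (of_nat (n - j)) * of_nat (num_fixed_points f (n - j))) = (0 :: rat))"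
proof -
  let ?z = "fps_to_fls (artin_mazur_zeta f)"
  define R where "R P \<longleftrightarrow> P \<noteq> 0 \<and> (\<forall>i. Polynomial.coeff P i \<in> rational_functions) \<and> poly P ?z = 0" for P
  \<comment> \<open>A minimal polynomial: among the nonzero annihilating polynomials one of least
    degree exists.\<close>
  obtain P where P: "R P" "\<And>Q. R Q \<Longrightarrow> Polynomial.degree P \<le> Polynomial.degree Q"
    using ex_has_least_nat[of R _ Polynomial.degree] assms unfolding algebraic_over_def R_def by blast
  interpret algebraic_differential rational_functions theta ?z P "Polynomial.degree P"
  proof
    show "0 \<in> rational_functions" using fls_of_poly_in[of 0] by simp
    show "1 \<in> rational_functions" using fls_of_poly_in[of 1] by simp
  qed (use P in \<open>auto simp: R_def theta_add theta_mult intro: rational_functions_add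
      rational_functions_mult rational_functions_uminus rational_functions_inverse rational_functions_theta\<close>)
  have "?z \<noteq> 0"
    using zeta_nth_0[of f] by auto
  then obtain c where c: "\<forall>i. c i \<in> rational_functions" "\<exists>i\<in>{..Polynomial.degree P}. c i \<noteq> 0"
    "(\<Sum>i\<le>Polynomial.degree P. c i * (theta ^^ i) (theta ?z / ?z)) = 0"
    using log_derivative_dependent by blast
  then obtain i0 where "i0 \<le> Polynomial.degree P" "c i0 \<noteq> 0" by auto
  then obtain J q where Jq: "\<exists>j\<le>J. q j \<noteq> 0" "\<forall>n\<ge>J. (\<Sum>j\<le>J. poly (q j) (of_nat (n - j)) *
      (if n - j = 0 then 0 else of_nat (num_fixed_points f (n - j)))) = (0 :: rat)"
    using dependent_iterates_recurrence[of c i0 "Polynomial.degree P"] c(1,3)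
    unfolding log_derivative_zeta by blast
  \<comment> \<open>The strict bound makes every \<open>n - j\<close> positive, so the coefficient
    set to 0 at index 0 never enters.\<close>
  have "(\<Sum>j\<le>J. poly (q j) (of_nat (n - j)) * of_nat (num_fixed_points f (n - j))) = (0 :: rat)"
    if "n > J" for n
  proof -
    have "(\<Sum>j\<le>J. poly (q j) (of_nat (n - j)) * of_nat (num_fixed_points f (n - j))) =
      (\<Sum>j\<le>J. poly (q j) (of_nat (n - j)) *
        (if n - j = 0 then 0 else of_nat (num_fixed_points f (n - j)) :: rat))"
      using that by (intro sum.cong) auto
    also have "\<dots> = 0" using Jq(2) that less_imp_le by blast
    finally show ?thesis .
  qed
  then show ?thesis using Jq(1) by blast
qed

theorem theorem1:
  fixes p :: nat
  assumes "Factorial_Ring.prime p"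
    and "CHAR('a::alg_closed_field) = p"
    and "\<And>x::'a. algebraic_over prime_subfield x"
  shows "(\<forall>f::'a poly. (\<exists>g. f = pcompose g (Polynomial.monom 1 p)) \<and> Polynomial.degree f \<ge> 2 \<longrightarrow>
            fps_to_fls (artin_mazur_zeta f) \<in> rational_functions) \<and>
         (\<forall>m::nat. m \<ge> 2 \<and> p dvd m \<longrightarrow>
            fps_to_fls (artin_mazur_zeta (Polynomial.monom 1 m :: 'a poly)) \<in> rational_functions) \<and>
         (\<forall>m::nat. m \<ge> 2 \<and> \<not> p dvd m \<longrightarrow>
            transcendental_over rational_functions
              (fps_to_fls (artin_mazur_zeta (Polynomial.monom 1 m :: 'a poly))))"
proof (intro conjI allI impI)
  have inseparable: "fps_to_fls (artin_mazur_zeta f) \<in> rational_functions"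
    if "f = pcompose g (Polynomial.monom 1 p)" "Polynomial.degree f \<ge> 2" for f g :: "'a poly"
    using that num_fixed_points_inseparable[of f g] assms(2)
    by (intro zeta_rational[of f "Polynomial.degree f"]) auto
  show "fps_to_fls (artin_mazur_zeta f) \<in> rational_functions"
    if "(\<exists>g. f = pcompose g (Polynomial.monom 1 p)) \<and> Polynomial.degree f \<ge> 2" for f :: "'a poly"
    using that inseparable by blast
  show "fps_to_fls (artin_mazur_zeta (Polynomial.monom 1 m :: 'a poly)) \<in> rational_functions"
    if m: "m \<ge> 2 \<and> p dvd m" for m
  proof -
    obtain k where k: "m = p * k" using m by blast
    \<comment> \<open>This writes \<open>x^m\<close> as \<open>x^k\<close> composed with
      \<open>x^p\<close>, an instance of the first claim.\<close>
    have "pcompose (Polynomial.monom 1 k) Q = Q ^ k" for Q :: "'a poly"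
      by (induction k) (auto simp: monom_Suc pcompose_pCons pcompose_1)
    then have eq: "Polynomial.monom 1 m = pcompose (Polynomial.monom 1 k) (Polynomial.monom (1::'a) p)"
      by (simp add: k monom_power mult.commute)
    show ?thesis
      by (rule inseparable[OF eq]) (use m in \<open>simp add: degree_monom_eq\<close>)
  qed
  show "transcendental_over rational_functions
      (fps_to_fls (artin_mazur_zeta (Polynomial.monom 1 m :: 'a poly)))"
    if m: "m \<ge> 2 \<and> \<not> p dvd m" for m
  proof
    assume "algebraic_over rational_functions
      (fps_to_fls (artin_mazur_zeta (Polynomial.monom 1 m :: 'a poly)))"
    then obtain J q where Jq: "\<exists>j\<le>J. q j \<noteq> 0" "\<And>n. n > J \<Longrightarrow>
        (\<Sum>j\<le>J. poly (q j) (of_nat (n - j)) *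
          of_nat (num_fixed_points (Polynomial.monom 1 m :: 'a poly) (n - j))) = (0 :: rat)"
      using zeta_algebraic_recurrence by blast
    have "(\<Sum>j\<le>J. poly (q j) (of_nat (n - j)) * (1 + (of_nat m ^ (n - j) - 1) /
        of_nat p ^ multiplicity (int p) (int m ^ (n - j) - 1))) = (0 :: rat)" if "n > J" for n
      unfolding Jq(2)[OF that, symmetric]
      using that m by (intro sum.cong refl arg_cong2[of _ _ _ _ "(*)"]
          num_fixed_points_monom[OF assms(1,2), symmetric]) auto
    then have "q j = 0" if "j \<le> J" for j
      using no_polynomial_recurrence[OF assms(1), of m J q j] m that by blast
    then show False using Jq(1) by blast
  qed
qed

end
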